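(* Let $E$ be a Banach lattice with order continuous norm and let $\mathcal{T} = (T_t)_{t \in J}$ be a bounded, positive semigroup on $E$, where either $J = \mathbb{N}$ or $J =(0,\infty)$. Assume that there exist a constant $M > 0$, a quasi-interior point $f_0$ of $E_+$ and a strictly positive functional $\psi \in E'_+$ such that $T_t f_0 \le M f_0$ and $T_t' \psi \le M \psi$ for all $t \in J$. Then the following assertions are equivalent: (i) $\mathcal{T}$ is strongly convergent (as $t\to\infty$) and the limit operator $P$ fulfils $P'\psi \ge \varepsilon \psi$ for some $\varepsilon > 0$. (ii) For every $f \in E_+$ with $\langle \psi, f \rangle = 1$ there exists a non-zero lower bound $h_f$ for $(\mathcal{T},f)$ with respect to $\psi$ such that $\inf_{f} \langle \psi, h_f \rangle > 0$, where the infimum runs over all $f \in E_+$ with $\langle\psi,f\rangle = 1$.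
   Context: All spaces are real. $\mathbb{N} = \{1,2,\dots\}$. $E_+$ is the positive cone of $E$, $E'$ the dual Banach lattice, and $T'$ the adjoint of $T$. A point $f_0 \in E_+$ is a quasi-interior point of $E_+$ if the principal ideal $E_{f_0} = \bigcup_{c>0}\{g \in E : |g|\le c f_0\}$ is dense in $E$. A functional $\psi \in E'$ is strictly positive if $\langle\psi,f\rangle>0$ for all $f\ge 0$, $f\neq 0$. A semigroup on $E$ is a family $(T_t)_{t \in J}$ of bounded linear operators on $E$ with $T_{t+s} = T_tT_s$ for all $s,t \in J$; no continuity in $t$ is assumed. It is bounded if $\sup_{t\in J}\|T_t\|<\infty$, and positive if $T_tE_+\subseteq E_+$ for all $t \in J$. Strongly convergent means convergent in the strong operator topology to a bounded linear operator. For $\psi \in E'_+$ and $f \in E_+$, a vector $h\in E_+$ is a lower bound for $(\mathcal{T},f)$ with respect to $\psi$ if $\langle\psi,(T_tf-h)^-\rangle\to 0$ as $t\to\infty$; here $g^- = (-g)\vee 0$. *)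

theory Defs
  imports "HOL-Analysis.Analysis" "HOL-Library.Lattice_Algebras"
begin

class banach_lattice = banach + ordered_real_vector + lattice_ab_group_add_abs +
  assumes norm_mono: "\<bar>x\<bar> \<le> \<bar>y\<bar> \<Longrightarrow> norm x \<le> norm y"

instance real :: banach_lattice
  by standard simp

text \<open>
  Order continuity of the norm: every decreasing net with infimum \<open>0\<close> converges to \<open>0\<close> in norm.
  Nets are replaced by downward directed sets \<open>D\<close>, regarded as nets indexed by themselves; a
  decreasing net converges to \<open>0\<close> in norm iff its range does.
\<close>
definition order_continuous_norm :: "'a::banach_lattice itself \<Rightarrow> bool" where
  "order_continuous_norm _ \<longleftrightarrow>
    (\<forall>D::'a set.
      D \<noteq> {} \<and> (\<forall>x\<in>D. \<forall>y\<in>D. \<exists>z\<in>D. z \<le> x \<and> z \<le> y) \<and>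
      (\<forall>x\<in>D. 0 \<le> x) \<and> (\<forall>l. (\<forall>x\<in>D. l \<le> x) \<longrightarrow> l \<le> 0)
      \<longrightarrow> (\<forall>e>0. \<exists>x\<^sub>0\<in>D. \<forall>x\<in>D. x \<le> x\<^sub>0 \<longrightarrow> norm x < e))"

definition principal_ideal :: "'a::banach_lattice \<Rightarrow> 'a set" where
  "principal_ideal u = (\<Union>c\<in>{0<..}. {g. \<bar>g\<bar> \<le> c *\<^sub>R u})"

definition quasi_interior :: "'a::banach_lattice \<Rightarrow> bool" where
  "quasi_interior u \<longleftrightarrow> 0 \<le> u \<and> closure (principal_ideal u) = UNIV"

definition dual_le :: "('a::banach_lattice \<Rightarrow>\<^sub>L real) \<Rightarrow> ('a \<Rightarrow>\<^sub>L real) \<Rightarrow> bool" where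
  "dual_le \<phi> \<psi> \<longleftrightarrow> (\<forall>f\<ge>0. \<phi> f \<le> \<psi> f)"

definition dual_op :: "('a::banach_lattice \<Rightarrow>\<^sub>L 'a) \<Rightarrow> ('a \<Rightarrow>\<^sub>L real) \<Rightarrow> ('a \<Rightarrow>\<^sub>L real)" where
  "dual_op S \<psi> = \<psi> o\<^sub>L S"

definition strictly_positive :: "('a::banach_lattice \<Rightarrow>\<^sub>L real) \<Rightarrow> bool" where
  "strictly_positive \<psi> \<longleftrightarrow> (\<forall>f\<ge>0. f \<noteq> 0 \<longrightarrow> 0 < \<psi> f)"

text \<open>
  Both admissible time sets, the positive integers and the positive reals, are treated as subsets
  \<open>J\<close> of the reals. A family indexed by \<open>J\<close> is a function on the reals of which only the values
  on \<open>J\<close> are ever used.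
\<close>
definition semigroup_on :: "real set \<Rightarrow> (real \<Rightarrow> 'a::banach_lattice \<Rightarrow>\<^sub>L 'a) \<Rightarrow> bool" where
  "semigroup_on J T \<longleftrightarrow> (\<forall>s\<in>J. \<forall>t\<in>J. T (t + s) = T t o\<^sub>L T s)"

definition positive_on :: "real set \<Rightarrow> (real \<Rightarrow> 'a::banach_lattice \<Rightarrow>\<^sub>L 'a) \<Rightarrow> bool" where
  "positive_on J T \<longleftrightarrow> (\<forall>t\<in>J. \<forall>f\<ge>0. 0 \<le> T t f)"

text \<open>The filter describing \<open>t \<rightarrow> \<infinity>\<close> with \<open>t\<close> ranging over \<open>J\<close>.\<close>
definition at_top_within :: "real set \<Rightarrow> real filter" where
  "at_top_within J = inf at_top (principal J)"

definition converges_strongly_to ::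
    "real set \<Rightarrow> (real \<Rightarrow> 'a::banach_lattice \<Rightarrow>\<^sub>L 'a) \<Rightarrow> ('a \<Rightarrow>\<^sub>L 'a) \<Rightarrow> bool" where
  "converges_strongly_to J T P \<longleftrightarrow> (\<forall>f. ((\<lambda>t. T t f) \<longlongrightarrow> P f) (at_top_within J))"

definition lower_bound ::
    "real set \<Rightarrow> (real \<Rightarrow> 'a::banach_lattice \<Rightarrow>\<^sub>L 'a) \<Rightarrow> ('a \<Rightarrow>\<^sub>L real) \<Rightarrow> 'a \<Rightarrow> 'a \<Rightarrow> bool" where
  "lower_bound J T \<psi> f h \<longleftrightarrow>
    0 \<le> h \<and> ((\<lambda>t. \<psi> (sup (- (T t f - h)) 0)) \<longlongrightarrow> 0) (at_top_within J)"

end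

theory Submission
  imports Defs
begin

text \<open>
  Suppose the semigroup converges to \<open>P\<close> with \<open>P' \<psi> \<ge> \<epsilon> \<psi>\<close>. Then \<open>P f\<close> itself is a lower bound
  for \<open>f\<close>, and \<open>\<psi> (P f) \<ge> \<epsilon>\<close> whenever \<open>\<psi> f = 1\<close>.

  The converse rests on lower bounds that are fixed vectors of the semigroup. Let \<open>0 \<le> f \<le> c u\<close>,
  where \<open>u\<close> is the quasi-interior point. All lower bounds for \<open>f\<close> lie in \<open>[0, c M u]\<close>, and order
  continuity of the norm yields a greatest one, \<open>g\<close> (lemma \<open>greatest_lower\<close>). Since each \<open>T t g\<close> is
  again a lower bound, \<open>T t g \<le> g\<close>, and the orbit of \<open>g\<close> decreases to a fixed vector \<open>k\<close>, still a
  lower bound for \<open>f\<close>, with \<open>\<psi> k \<ge> \<epsilon>\<^sup>2 \<psi> f\<close> (lemma \<open>invariant_lower\<close>).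

  Now split \<open>T t f = k + f' - r\<close> with \<open>f' = (T t f - k)\<^sup>+\<close>, where \<open>r\<close> is negligible for large \<open>t\<close>.
  The operators need not contract \<open>\<psi>\<close>, so progress is measured by \<open>p f = sup \<psi> (T t f)\<close>, taken
  over all \<open>t\<close>, which does not increase along orbits. Because \<open>k\<close> is fixed, subtracting it lowers
  the whole orbit of \<open>\<psi>\<close>-values by \<open>\<psi> k \<ge> (\<epsilon>\<^sup>2 / M) p f\<close>. Hence \<open>p f' \<le> (1 - \<epsilon>\<^sup>2 / M) p f\<close>
  up to a small error (lemma \<open>contraction_step\<close>). Applying the same splitting to \<open>f'\<close> repeatedly
  shows that \<open>T t f\<close> comes arbitrarily close to fixed vectors in the seminorm \<open>\<psi> \<bar>\<cdot>\<bar>\<close>, and so is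
  Cauchy for it.

  On an order interval, smallness of \<open>\<psi> \<bar>x\<bar>\<close> forces smallness of the norm, again by order
  continuity (lemma \<open>norm_small_if_functional_small\<close>). So \<open>T t f\<close> is norm Cauchy for \<open>f\<close> in the
  principal ideal of \<open>u\<close>; this ideal is dense and the operators are uniformly bounded, which gives
  strong convergence. The lower bounds pass to the limit as \<open>P' \<psi> \<ge> \<epsilon> \<psi>\<close>. Time enters
  only through sums and differences of elements of \<open>J\<close> and through the integer times in \<open>J\<close>, so both
  time sets are covered at once.
\<close>

section \<open>Order and norm in Banach lattices\<close>

lemma pprt_le_iff: "0 \<le> b \<Longrightarrow> pprt a \<le> b \<longleftrightarrow> a \<le> b" for a b :: "'a::lattice_ab_group_add"
  by (simp add: pprt_def)

lemma le_pprt: "a \<le> pprt a" for a :: "'a::lattice_ab_group_add"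
  by (simp add: pprt_def)

lemma pprt_add_le: "pprt (a + b) \<le> pprt a + pprt b" for a b :: "'a::lattice_ab_group_add"
  by (simp add: pprt_le_iff add_mono le_pprt)

lemma pprt_le_abs: "pprt a \<le> \<bar>a\<bar>" for a :: "'a::lattice_ab_group_add_abs"
  by (simp add: pprt_le_iff abs_ge_self)

lemma pprt_diff_uminus: "pprt a - pprt (- a) = a" for a :: "'a::lattice_ab_group_add"
  using prts[of a] by (simp add: pprt_neg)

lemma norm_mono_nonneg: "0 \<le> x \<Longrightarrow> x \<le> y \<Longrightarrow> norm x \<le> norm y" for x y :: "'a::banach_lattice"
  by (rule norm_mono) (simp add: abs_of_nonneg order_trans)

lemma norm_pprt_le: "norm (pprt x) \<le> norm x" for x :: "'a::banach_lattice"
  by (rule norm_mono) (simp add: pprt_le_abs)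

text \<open>The cone is closed because the negative part does not increase the norm.\<close>

lemma tendsto_nonneg:
  fixes l :: "'a::banach_lattice"
  assumes lim: "(f \<longlongrightarrow> l) F" and F: "F \<noteq> bot" and ev: "\<forall>\<^sub>F x in F. 0 \<le> f x"
  shows "0 \<le> l"
proof -
  have "\<forall>\<^sub>F x in F. norm (pprt (- l)) \<le> norm (f x - l)"
    using ev
  proof eventually_elim
    case (elim x)
    have "- l \<le> f x - l"
      using elim by simp
    then have "pprt (- l) \<le> pprt (f x - l)"
      by (rule pprt_mono)
    then have "norm (pprt (- l)) \<le> norm (pprt (f x - l))"
      by (intro norm_mono_nonneg) auto
    also have "\<dots> \<le> norm (f x - l)"
      by (rule norm_pprt_le)
    finally show ?case .
  qed
  moreover have "((\<lambda>x. norm (f x - l)) \<longlongrightarrow> 0) F"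
    using lim by (simp add: LIM_zero_iff tendsto_norm_zero)
  ultimately have "norm (pprt (- l)) \<le> 0"
    using F tendsto_lowerbound by blast
  then show ?thesis
    using le_pprt[of "- l"] by simp
qed

lemma tendsto_le_lattice:
  fixes l m :: "'a::banach_lattice"
  assumes "(f \<longlongrightarrow> l) F" "(g \<longlongrightarrow> m) F" "F \<noteq> bot" "\<forall>\<^sub>F x in F. f x \<le> g x"
  shows "l \<le> m"
  using tendsto_nonneg[OF tendsto_diff[OF assms(2,1)] assms(3)] assms(4) by simp

lemma archimedean_lattice:
  fixes l w :: "'a::banach_lattice"
  assumes "\<And>n::nat. of_nat n *\<^sub>R l \<le> w"
  shows "l \<le> 0"
proof (rule tendsto_le_lattice)
  show "\<forall>\<^sub>F n in sequentially. l \<le> inverse (real (Suc n)) *\<^sub>R w"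
  proof (intro always_eventually allI)
    fix n
    have "inverse (real (Suc n)) *\<^sub>R (of_nat (Suc n) *\<^sub>R l) \<le> inverse (real (Suc n)) *\<^sub>R w"
      by (intro scaleR_left_mono assms) auto
    then show "l \<le> inverse (real (Suc n)) *\<^sub>R w"
      by (simp del: of_nat_Suc)
  qed
  show "(\<lambda>n. inverse (real (Suc n)) *\<^sub>R w) \<longlonglongrightarrow> 0"
    using tendsto_scaleR[OF LIMSEQ_inverse_real_of_nat tendsto_const[of w]] by simp
qed auto

lemma order_continuous_normD:
  fixes D :: "'a::banach_lattice set"
  assumes oc: "order_continuous_norm TYPE('a)" and "D \<noteq> {}"
    and dir: "\<And>x y. x \<in> D \<Longrightarrow> y \<in> D \<Longrightarrow> \<exists>z\<in>D. z \<le> x \<and> z \<le> y"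
    and nonneg: "\<And>x. x \<in> D \<Longrightarrow> 0 \<le> x"
    and inf: "\<And>l. \<forall>x\<in>D. l \<le> x \<Longrightarrow> l \<le> 0"
    and "e > 0"
  obtains d where "d \<in> D" "\<And>x. x \<in> D \<Longrightarrow> x \<le> d \<Longrightarrow> norm x < e"
proof -
  note oc[unfolded order_continuous_norm_def, THEN spec[of _ D]]
  moreover have "D \<noteq> {} \<and> (\<forall>x\<in>D. \<forall>y\<in>D. \<exists>z\<in>D. z \<le> x \<and> z \<le> y) \<and>
      (\<forall>x\<in>D. 0 \<le> x) \<and> (\<forall>l. (\<forall>x\<in>D. l \<le> x) \<longrightarrow> l \<le> 0)"
    using \<open>D \<noteq> {}\<close> dir nonneg inf by simp
  ultimately have "\<forall>e>0. \<exists>d\<in>D. \<forall>x\<in>D. x \<le> d \<longrightarrow> norm x < e"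
    by (rule mp)
  with \<open>e > 0\<close> that show ?thesis
    by blast
qed

text \<open>
  The differences between upper bounds and members of the sequence have infimum \<open>0\<close>: a lower
  bound of them can be subtracted from an upper bound arbitrarily often. Order continuity then
  makes the sequence Cauchy.
\<close>

lemma increasing_order_bounded_convergent:
  fixes x :: "nat \<Rightarrow> 'a::banach_lattice"
  assumes oc: "order_continuous_norm TYPE('a)"
    and inc: "incseq x" and bd: "\<And>n. x n \<le> u"
  obtains l where "x \<longlonglongrightarrow> l" "\<And>n. x n \<le> l"
proof -
  define U where "U = {y. \<forall>n. x n \<le> y}"
  define D where "D = {y - x n | y n. y \<in> U}"
  have uU: "u \<in> U"
    using bd by (simp add: U_def)
  have D_nonempty: "D \<noteq> {}"
    using uU by (auto simp: D_def)
  have D_dir: "\<exists>z\<in>D. z \<le> a \<and> z \<le> b" if ab: "a \<in> D" "b \<in> D" for a b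
  proof -
    obtain y n y' n' where a: "a = y - x n" "y \<in> U" and b: "b = y' - x n'" "y' \<in> U"
      using ab by (auto simp: D_def)
    have "inf y y' \<in> U"
      using a b by (simp add: U_def)
    then have "inf y y' - x (max n n') \<in> D"
      by (auto simp: D_def)
    moreover have "x n \<le> x (max n n')" "x n' \<le> x (max n n')"
      using inc by (auto simp: incseq_def)
    then have "inf y y' - x (max n n') \<le> a" "inf y y' - x (max n n') \<le> b"
      using a b by (auto intro!: diff_mono)
    ultimately show ?thesis
      by blast
  qed
  have D_nonneg: "0 \<le> a" if "a \<in> D" for a
    using that by (auto simp: D_def U_def)
  have D_inf: "l \<le> 0" if l: "\<forall>a\<in>D. l \<le> a" for l
  proof -
    have "u - of_nat k *\<^sub>R l \<in> U" for k :: nat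
    proof (induction k)
      case 0
      then show ?case
        using uU by simp
    next
      case (Suc k)
      have "x n \<le> u - of_nat k *\<^sub>R l - l" for n
      proof -
        have "u - of_nat k *\<^sub>R l - x n \<in> D"
          using Suc by (auto simp: D_def)
        with l have "l \<le> u - of_nat k *\<^sub>R l - x n"
          by blast
        then show ?thesis
          by (simp add: algebra_simps)
      qed
      then show ?case
        by (simp add: U_def algebra_simps)
    qed
    then have "of_nat k *\<^sub>R l \<le> u - x 0" for k :: nat
      by (simp add: U_def algebra_simps)
    then show ?thesis
      by (rule archimedean_lattice)
  qed
  have "Cauchy x"
  proof (rule CauchyI)
    fix e :: real
    assume "0 < e"
    then have "0 < e / 2"
      by simp
    obtain d where d: "d \<in> D" "\<And>a. a \<in> D \<Longrightarrow> a \<le> d \<Longrightarrow> norm a < e / 2"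
      by (rule order_continuous_normD[OF oc D_nonempty D_dir D_nonneg D_inf \<open>0 < e / 2\<close>]) blast+
    then obtain y N where y: "d = y - x N" "y \<in> U"
      by (auto simp: D_def)
    have near: "norm (y - x n) < e / 2" if "n \<ge> N" for n
    proof (rule d(2))
      show "y - x n \<in> D"
        using y by (auto simp: D_def)
      show "y - x n \<le> d"
        using inc that by (simp add: y incseq_def)
    qed
    have "norm (x m - x n) < e" if "m \<ge> N" "n \<ge> N" for m n
      using norm_triangle_ineq4[of "y - x n" "y - x m"] near[OF that(1)] near[OF that(2)] by simp
    then show "\<exists>N. \<forall>m\<ge>N. \<forall>n\<ge>N. norm (x m - x n) < e"
      by blast
  qed
  then obtain l where l: "x \<longlonglongrightarrow> l"
    using Cauchy_convergent_iff convergent_def by blast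
  have "x n \<le> l" for n
    by (rule tendsto_le_lattice[OF tendsto_const l])
      (use inc in \<open>auto simp: incseq_def eventually_sequentially\<close>)
  with l show ?thesis
    by (rule that)
qed

lemma decreasing_nonneg_convergent:
  fixes x :: "nat \<Rightarrow> 'a::banach_lattice"
  assumes oc: "order_continuous_norm TYPE('a)"
    and dec: "decseq x" and nonneg: "\<And>n. 0 \<le> x n"
  obtains l where "x \<longlonglongrightarrow> l" "\<And>n. l \<le> x n" "0 \<le> l"
proof -
  obtain l where l: "(\<lambda>n. - x n) \<longlonglongrightarrow> l" "\<And>n. - x n \<le> l"
    by (rule increasing_order_bounded_convergent[OF oc, of "\<lambda>n. - x n" 0])
      (use dec nonneg in \<open>auto simp: decseq_def incseq_def\<close>)
  have "x \<longlonglongrightarrow> - l"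
    using tendsto_minus[OF l(1)] by simp
  moreover have "0 \<le> - l"
    using tendsto_nonneg[OF \<open>x \<longlonglongrightarrow> - l\<close>] nonneg by simp
  ultimately show ?thesis
    using l(2) by (intro that[of "- l"]) (auto simp: minus_le_iff)
qed

section \<open>Strictly positive functionals on order intervals\<close>

lemma strictly_positive_nonneg: "strictly_positive \<psi> \<Longrightarrow> 0 \<le> f \<Longrightarrow> 0 \<le> \<psi> f"
  by (cases "f = 0") (auto simp: strictly_positive_def less_imp_le)

lemma strictly_positive_mono: "strictly_positive \<psi> \<Longrightarrow> f \<le> g \<Longrightarrow> \<psi> f \<le> \<psi> g"
  using strictly_positive_nonneg[of \<psi> "g - f"] by (simp add: blinfun.diff_right)

lemma strictly_positive_eq_0D: "strictly_positive \<psi> \<Longrightarrow> 0 \<le> f \<Longrightarrow> \<psi> f \<le> 0 \<Longrightarrow> f = 0"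
  unfolding strictly_positive_def by (meson not_le)

text \<open>
  Otherwise the interval contains vectors \<open>x k\<close> with \<open>\<psi> (x k) \<le> 2 ^ - k\<close> whose norms stay away
  from \<open>0\<close>. The suprema \<open>v k\<close> of their tails decrease, and they have infimum \<open>0\<close> since
  \<open>\<psi> (v k) \<longlonglongrightarrow> 0\<close>; order continuity then forces \<open>norm (x k) \<le> norm (v k) \<longlonglongrightarrow> 0\<close>.
\<close>

lemma norm_small_if_functional_small:
  fixes u :: "'a::banach_lattice"
  assumes oc: "order_continuous_norm TYPE('a)" and sp: "strictly_positive \<psi>" and "e > 0"
  obtains \<delta> where "\<delta> > 0" "\<And>x. \<bar>x\<bar> \<le> u \<Longrightarrow> \<psi> \<bar>x\<bar> \<le> \<delta> \<Longrightarrow> norm x < e"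
proof (rule ccontr)
  assume contra: "\<not> thesis"
  have "\<exists>x. 0 \<le> x \<and> x \<le> u \<and> \<psi> x \<le> (1/2) ^ k \<and> e \<le> norm x" for k :: nat
  proof (rule ccontr)
    assume no: "\<not> ?thesis"
    have "norm x < e" if x: "\<bar>x\<bar> \<le> u" "\<psi> \<bar>x\<bar> \<le> (1/2) ^ k" for x
    proof -
      have "norm x \<le> norm \<bar>x\<bar>"
        by (rule norm_mono) simp
      moreover have "norm \<bar>x\<bar> < e"
        using no x abs_ge_zero[of x] not_less by blast
      ultimately show ?thesis
        by simp
    qed
    with contra that[of "(1/2) ^ k"] show False
      by simp
  qed
  then obtain x where x: "\<And>k. 0 \<le> x k" "\<And>k. x k \<le> u" "\<And>k. \<psi> (x k) \<le> (1/2) ^ k"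
      "\<And>k. e \<le> norm (x k)"
    by metis
  \<comment> \<open>\<open>w k m\<close> is the supremum of \<open>x k, \<dots>, x (k + m)\<close>.\<close>
  define w where "w k m = rec_nat (x k) (\<lambda>j y. sup y (x (k + Suc j))) m" for k m
  have w0: "w k 0 = x k" and wSuc: "w k (Suc m) = sup (w k m) (x (k + Suc m))" for k m
    by (simp_all add: w_def)
  have w_nonneg: "0 \<le> w k m" for k m
    by (induction m) (auto simp: w0 wSuc x intro: le_supI1)
  have w_le: "w k m \<le> u" for k m
    by (induction m) (auto simp: w0 wSuc x)
  have w_psi: "\<psi> (w k m) \<le> 2 * (1/2) ^ k - (1/2) ^ (k + m)" for k m
  proof (induction m)
    case 0
    then show ?case
      using x(3)[of k] by (simp add: w0)
  next
    case (Suc m)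
    have "w k (Suc m) \<le> w k m + x (k + Suc m)"
      using w_nonneg[of k m] x(1)[of "k + Suc m"] by (simp add: wSuc)
    then have "\<psi> (w k (Suc m)) \<le> \<psi> (w k m) + \<psi> (x (k + Suc m))"
      using strictly_positive_mono[OF sp] by (metis blinfun.add_right)
    moreover have "(1/2::real) ^ (k + m) = 2 * (1/2) ^ (k + Suc m)"
      by simp
    ultimately show ?case
      using Suc x(3)[of "k + Suc m"] by linarith
  qed
  have w_shift: "w (Suc k) m \<le> w k (Suc m)" for k m
  proof (induction m)
    case 0
    then show ?case
      by (simp add: w0 wSuc)
  next
    case (Suc m)
    then show ?case
      unfolding wSuc[of "Suc k" m] wSuc[of k "Suc m"] by (intro sup_mono) auto
  qed
  have "\<exists>l. w k \<longlonglongrightarrow> l \<and> (\<forall>m. w k m \<le> l)" for k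
  proof -
    have "incseq (w k)"
      by (rule incseq_SucI) (simp add: wSuc)
    then obtain l where "w k \<longlonglongrightarrow> l" "\<And>m. w k m \<le> l"
      by (rule increasing_order_bounded_convergent[OF oc _ w_le]) blast
    then show ?thesis
      by blast
  qed
  then obtain v where v: "\<And>k. w k \<longlonglongrightarrow> v k" "\<And>k m. w k m \<le> v k"
    by metis
  have x_le_v: "x k \<le> v k" for k
    using v(2)[of k 0] by (simp add: w0)
  have v_psi: "\<psi> (v k) \<le> 2 * (1/2) ^ k" for k
  proof (rule tendsto_upperbound)
    show "(\<lambda>m. \<psi> (w k m)) \<longlonglongrightarrow> \<psi> (v k)"
      by (intro tendsto_intros v)
    show "\<forall>\<^sub>F m in sequentially. \<psi> (w k m) \<le> 2 * (1/2) ^ k"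
    proof (intro always_eventually allI)
      fix m
      have "0 \<le> (1/2::real) ^ (k + m)"
        by simp
      with w_psi[of k m] show "\<psi> (w k m) \<le> 2 * (1/2) ^ k"
        by linarith
    qed
  qed auto
  have "decseq v"
  proof (rule decseq_SucI)
    show "v (Suc k) \<le> v k" for k
      by (rule tendsto_le_lattice[OF v(1) tendsto_const])
        (use order_trans[OF w_shift v(2)] in auto)
  qed
  moreover have v_nonneg: "0 \<le> v k" for k
    using x(1) x_le_v by (rule order_trans)
  ultimately obtain l where l: "v \<longlonglongrightarrow> l" "\<And>k. l \<le> v k" "0 \<le> l"
    by (rule decreasing_nonneg_convergent[OF oc]) blast
  have "\<psi> l \<le> 0"
  proof (rule tendsto_lowerbound)
    show "(\<lambda>k. 2 * (1/2) ^ k :: real) \<longlonglongrightarrow> 0"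
      by (intro tendsto_mult_right_zero LIMSEQ_realpow_zero) auto
    show "\<forall>\<^sub>F k in sequentially. \<psi> l \<le> 2 * (1/2) ^ k"
      using strictly_positive_mono[OF sp l(2)] v_psi
      by (intro always_eventually allI) (rule order_trans)
  qed auto
  with sp l(3) have "l = 0"
    by (rule strictly_positive_eq_0D)
  then have "(\<lambda>k. norm (v k)) \<longlonglongrightarrow> 0"
    using l(1) by (simp add: tendsto_norm_zero)
  moreover have "e \<le> norm (v k)" for k
    using x(4) norm_mono_nonneg[OF x(1) x_le_v] by (rule order_trans)
  ultimately have "e \<le> 0"
    by (intro tendsto_lowerbound) auto
  with \<open>e > 0\<close> show False
    by simp
qed

section \<open>Dominated positive semigroups\<close>

lemma eventually_at_top_within:
  "eventually P (at_top_within J) \<longleftrightarrow> (\<exists>N. \<forall>t\<in>J. N \<le> t \<longrightarrow> P t)"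
  by (auto simp: at_top_within_def eventually_inf_principal eventually_at_top_linorder)

locale dominated_semigroup =
  fixes J :: "real set"
    and T :: "real \<Rightarrow> 'a::banach_lattice \<Rightarrow>\<^sub>L 'a"
    and M :: real
    and u :: 'a
    and \<psi> :: "'a \<Rightarrow>\<^sub>L real"
  assumes oc: "order_continuous_norm TYPE('a)"
    and J_cases: "J = \<nat> - {0} \<or> J = {0<..}"
    and semigroup: "semigroup_on J T"
    and bounded_T: "bounded (T ` J)"
    and positive: "positive_on J T"
    and M_pos: "M > 0"
    and quasi_interior: "quasi_interior u"
    and strictly_positive: "strictly_positive \<psi>"
    and T_u_le: "t \<in> J \<Longrightarrow> T t u \<le> M *\<^sub>R u"
    and dual_T_le: "t \<in> J \<Longrightarrow> dual_le (dual_op (T t) \<psi>) (M *\<^sub>R \<psi>)"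
begin

lemma J_pos: "t \<in> J \<Longrightarrow> 0 < t"
  using J_cases by (auto elim: Nats_cases)

lemma J_of_nat: "0 < n \<Longrightarrow> real n \<in> J"
  using J_cases by auto

lemma J_add: "s \<in> J \<Longrightarrow> t \<in> J \<Longrightarrow> s + t \<in> J"
  using J_cases by (auto elim!: Nats_cases simp flip: of_nat_add)

lemma J_diff:
  assumes "s \<in> J" "t \<in> J" "s < t"
  shows "t - s \<in> J"
  using J_cases
proof
  assume J: "J = \<nat> - {0}"
  then obtain m n where "s = of_nat m" "t = of_nat n"
    using assms by (auto elim!: Nats_cases)
  then have "t - s = of_nat (n - m)"
    using assms by simp
  then show ?thesis
    using J assms by simp
qed (use assms in simp)

lemma J_unbounded: "\<exists>t\<in>J. N \<le> t"
proof -
  obtain n where "N \<le> real n"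
    using real_arch_simple by blast
  then show ?thesis
    by (intro bexI[of _ "real (Suc n)"]) (auto intro: J_of_nat simp del: of_nat_Suc)
qed

lemma at_top_within_nontrivial: "at_top_within J \<noteq> bot"
  using J_unbounded by (auto simp: trivial_limit_def eventually_at_top_within)

lemma T_add: "s \<in> J \<Longrightarrow> t \<in> J \<Longrightarrow> T (t + s) f = T t (T s f)"
  using semigroup by (simp add: semigroup_on_def)

lemma T_nonneg: "t \<in> J \<Longrightarrow> 0 \<le> f \<Longrightarrow> 0 \<le> T t f"
  using positive by (simp add: positive_on_def)

lemma T_mono: "t \<in> J \<Longrightarrow> f \<le> g \<Longrightarrow> T t f \<le> T t g"
  using T_nonneg[of t "g - f"] by (simp add: blinfun.diff_right)

text \<open>Together with positivity, this keeps the orbit of a positive vector of the principal ideal in one order interval.\<close>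

lemma T_le_scaled_u:
  assumes "t \<in> J" "f \<le> c *\<^sub>R u" "0 \<le> c"
  shows "T t f \<le> (c * M) *\<^sub>R u"
proof -
  have "T t f \<le> c *\<^sub>R T t u"
    using T_mono[OF assms(1,2)] by (simp add: blinfun.scaleR_right)
  also have "\<dots> \<le> c *\<^sub>R (M *\<^sub>R u)"
    using T_u_le[OF assms(1)] assms(3) by (rule scaleR_left_mono)
  finally show ?thesis
    by simp
qed

lemmas psi_nonneg = strictly_positive_nonneg[OF strictly_positive]
lemmas psi_mono = strictly_positive_mono[OF strictly_positive]
lemmas psi_eq_0D = strictly_positive_eq_0D[OF strictly_positive]

lemma psi_T_le: "t \<in> J \<Longrightarrow> 0 \<le> f \<Longrightarrow> \<psi> (T t f) \<le> M * \<psi> f"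
  using dual_T_le by (simp add: dual_le_def dual_op_def blinfun.scaleR_left)

section \<open>Lower bounds\<close>

abbreviation lower :: "'a \<Rightarrow> 'a \<Rightarrow> bool"
  where "lower \<equiv> lower_bound J T \<psi>"

lemma lower_iff_tendsto:
  "lower f h \<longleftrightarrow> 0 \<le> h \<and> ((\<lambda>t. \<psi> (pprt (h - T t f))) \<longlongrightarrow> 0) (at_top_within J)"
  by (simp add: lower_bound_def pprt_def)

lemma lowerI:
  assumes "0 \<le> h"
    and "\<And>e. e > 0 \<Longrightarrow> \<exists>N. \<forall>t\<in>J. N \<le> t \<longrightarrow> \<psi> (pprt (h - T t f)) \<le> e"
  shows "lower f h"
  unfolding lower_iff_tendsto
proof (intro conjI tendstoI)
  fix e :: real
  assume "e > 0"
  then obtain N where "\<forall>t\<in>J. N \<le> t \<longrightarrow> \<psi> (pprt (h - T t f)) \<le> e / 2"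
    using assms(2)[of "e / 2"] by auto
  then have "\<forall>t\<in>J. N \<le> t \<longrightarrow> dist (\<psi> (pprt (h - T t f))) 0 < e"
    using \<open>e > 0\<close> psi_nonneg[OF zero_le_pprt] by fastforce
  then show "\<forall>\<^sub>F t in at_top_within J. dist (\<psi> (pprt (h - T t f))) 0 < e"
    by (auto simp: eventually_at_top_within)
qed (fact assms(1))

lemma lowerD:
  assumes "lower f h" "e > 0"
  obtains N where "\<And>t. t \<in> J \<Longrightarrow> N \<le> t \<Longrightarrow> \<psi> (pprt (h - T t f)) \<le> e"
proof -
  have "\<forall>\<^sub>F t in at_top_within J. \<psi> (pprt (h - T t f)) < e"
    using assms by (auto simp: lower_iff_tendsto intro: order_tendstoD)
  then show ?thesis
    using that by (auto simp: eventually_at_top_within intro: less_imp_le)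
qed

lemma lower_nonneg: "lower f h \<Longrightarrow> 0 \<le> h"
  by (simp add: lower_bound_def)

lemma lower_zero:
  assumes "0 \<le> f"
  shows "lower f 0"
proof (rule lowerI)
  fix e :: real
  assume "e > 0"
  then have "\<forall>t\<in>J. 0 \<le> t \<longrightarrow> \<psi> (pprt (0 - T t f)) \<le> e"
    using assms by (simp add: T_nonneg)
  then show "\<exists>N. \<forall>t\<in>J. N \<le> t \<longrightarrow> \<psi> (pprt (0 - T t f)) \<le> e"
    by blast
qed simp

lemma lower_sup:
  assumes "lower f g" "lower f h"
  shows "lower f (sup g h)"
proof (rule lowerI)
  fix e :: real
  assume "e > 0"
  then have "e / 2 > 0"
    by simp
  obtain N1 where N1: "\<And>t. t \<in> J \<Longrightarrow> N1 \<le> t \<Longrightarrow> \<psi> (pprt (g - T t f)) \<le> e / 2"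
    using lowerD[OF assms(1) \<open>e / 2 > 0\<close>] by blast
  obtain N2 where N2: "\<And>t. t \<in> J \<Longrightarrow> N2 \<le> t \<Longrightarrow> \<psi> (pprt (h - T t f)) \<le> e / 2"
    using lowerD[OF assms(2) \<open>e / 2 > 0\<close>] by blast
  have "\<psi> (pprt (sup g h - T t f)) \<le> e" if "t \<in> J" "max N1 N2 \<le> t" for t
  proof -
    have "sup g h \<le> T t f + (pprt (g - T t f) + pprt (h - T t f))"
    proof (rule sup_least)
      have "g - T t f \<le> pprt (g - T t f) + pprt (h - T t f)"
        using add_mono[OF le_pprt zero_le_pprt] by simp
      then show "g \<le> T t f + (pprt (g - T t f) + pprt (h - T t f))"
        by (simp add: algebra_simps)
      have "h - T t f \<le> pprt (g - T t f) + pprt (h - T t f)"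
        using add_mono[OF zero_le_pprt le_pprt] by simp
      then show "h \<le> T t f + (pprt (g - T t f) + pprt (h - T t f))"
        by (simp add: algebra_simps)
    qed
    then have "pprt (sup g h - T t f) \<le> pprt (g - T t f) + pprt (h - T t f)"
      by (simp add: pprt_le_iff algebra_simps)
    then have "\<psi> (pprt (sup g h - T t f)) \<le> \<psi> (pprt (g - T t f)) + \<psi> (pprt (h - T t f))"
      using psi_mono by (metis blinfun.add_right)
    then show ?thesis
      using N1[of t] N2[of t] that by simp
  qed
  then show "\<exists>N. \<forall>t\<in>J. N \<le> t \<longrightarrow> \<psi> (pprt (sup g h - T t f)) \<le> e"
    by blast
qed (use assms in \<open>auto dest: lower_nonneg intro: le_supI1\<close>)

text \<open>
  By positivity the excess of \<open>T s h\<close> over \<open>T (s + t) f\<close> is at most the image under \<open>T s\<close> of the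
  excess of \<open>h\<close> over \<open>T t f\<close>, and \<open>\<psi> \<circ> T s\<close> is dominated by \<open>M * \<psi>\<close>.
\<close>

lemma lower_T:
  assumes "lower f h" "s \<in> J"
  shows "lower f (T s h)"
proof (rule lowerI)
  fix e :: real
  assume "e > 0"
  then have "e / M > 0"
    using M_pos by simp
  then obtain N where N: "\<And>t. t \<in> J \<Longrightarrow> N \<le> t \<Longrightarrow> \<psi> (pprt (h - T t f)) \<le> e / M"
    using lowerD[OF assms(1)] by blast
  have "\<psi> (pprt (T s h - T t f)) \<le> e" if t: "t \<in> J" "max (N + s) (s + 1) \<le> t" for t
  proof -
    have ts: "t - s \<in> J"
      using t assms(2) by (intro J_diff) auto
    let ?r = "pprt (h - T (t - s) f)"
    have "T t f = T s (T (t - s) f)"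
      using T_add[OF ts assms(2)] by simp
    then have "T s h - T t f = T s (h - T (t - s) f)"
      by (simp add: blinfun.diff_right)
    also have "\<dots> \<le> T s ?r"
      using assms(2) le_pprt by (rule T_mono)
    finally have "pprt (T s h - T t f) \<le> T s ?r"
      using assms(2) by (simp add: pprt_le_iff T_nonneg)
    then have "\<psi> (pprt (T s h - T t f)) \<le> \<psi> (T s ?r)"
      by (rule psi_mono)
    also have "\<dots> \<le> M * \<psi> ?r"
      using assms(2) by (intro psi_T_le) auto
    also have "\<dots> \<le> M * (e / M)"
      using N[OF ts] t M_pos by (intro mult_left_mono) auto
    finally show ?thesis
      using M_pos by simp
  qed
  then show "\<exists>N. \<forall>t\<in>J. N \<le> t \<longrightarrow> \<psi> (pprt (T s h - T t f)) \<le> e"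
    by blast
qed (use assms in \<open>auto dest: lower_nonneg intro: T_nonneg\<close>)

lemma lower_limit:
  assumes "\<And>n. lower f (h n)" and lim: "h \<longlonglongrightarrow> l"
  shows "lower f l"
proof (rule lowerI)
  show "0 \<le> l"
    by (rule tendsto_nonneg[OF lim])
      (use lower_nonneg[OF assms(1)] in \<open>auto intro: always_eventually\<close>)
  fix e :: real
  assume "e > 0"
  have "(\<lambda>n. norm \<psi> * norm (l - h n)) \<longlonglongrightarrow> norm \<psi> * norm (l - l)"
    by (intro tendsto_intros lim)
  then have "\<forall>\<^sub>F n in sequentially. norm \<psi> * norm (l - h n) < e / 2"
    using \<open>e > 0\<close> by (intro order_tendstoD(2)) auto
  then obtain n where n: "norm \<psi> * norm (l - h n) < e / 2"
    by (auto simp: eventually_sequentially)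
  have "e / 2 > 0"
    using \<open>e > 0\<close> by simp
  then obtain N where N: "\<And>t. t \<in> J \<Longrightarrow> N \<le> t \<Longrightarrow> \<psi> (pprt (h n - T t f)) \<le> e / 2"
    using lowerD[OF assms(1)] by blast
  have "\<psi> (pprt (l - T t f)) \<le> e" if t: "t \<in> J" "N \<le> t" for t
  proof -
    have "pprt (l - T t f) \<le> pprt (l - h n) + pprt (h n - T t f)"
      using pprt_add_le[of "l - h n" "h n - T t f"] by simp
    then have "\<psi> (pprt (l - T t f)) \<le> \<psi> (pprt (l - h n)) + \<psi> (pprt (h n - T t f))"
      using psi_mono by (metis blinfun.add_right)
    moreover have "\<psi> (pprt (l - h n)) \<le> norm \<psi> * norm (pprt (l - h n))"
      using norm_blinfun[of \<psi> "pprt (l - h n)"] by simp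
    moreover have "norm \<psi> * norm (pprt (l - h n)) \<le> norm \<psi> * norm (l - h n)"
      by (intro mult_left_mono norm_pprt_le) auto
    ultimately show ?thesis
      using n N[OF t] by linarith
  qed
  then show "\<exists>N. \<forall>t\<in>J. N \<le> t \<longrightarrow> \<psi> (pprt (l - T t f)) \<le> e"
    by blast
qed

text \<open>
  The orbit stays below \<open>c M u\<close>, so the part of \<open>h\<close> above \<open>c M u\<close> is part of every excess
  \<open>(h - T t f)\<^sup>+\<close>; its \<open>\<psi>\<close>-value is therefore \<open>0\<close>.
\<close>

lemma lower_le:
  assumes "lower f h" "f \<le> c *\<^sub>R u" "0 \<le> c"
  shows "h \<le> (c * M) *\<^sub>R u"
proof -
  let ?r = "pprt (h - (c * M) *\<^sub>R u)"
  have "\<psi> ?r \<le> e" if e: "e > 0" for e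
  proof -
    obtain N where N: "\<And>t. t \<in> J \<Longrightarrow> N \<le> t \<Longrightarrow> \<psi> (pprt (h - T t f)) \<le> e"
      using lowerD[OF assms(1) e] by blast
    obtain t where t: "t \<in> J" "N \<le> t"
      using J_unbounded by blast
    have "?r \<le> pprt (h - T t f)"
      using T_le_scaled_u[OF t(1) assms(2,3)] by (intro pprt_mono diff_left_mono)
    then show ?thesis
      using psi_mono N[OF t] by (meson order_trans)
  qed
  then have "\<psi> ?r \<le> 0"
    by (rule field_le_epsilon) simp
  then have "?r = 0"
    by (intro psi_eq_0D) auto
  then show ?thesis
    using le_pprt[of "h - (c * M) *\<^sub>R u"] by simp
qed

lemma psi_lower_le_limit:
  assumes "lower f h" "filterlim \<tau> at_top sequentially" "\<And>n. \<tau> n \<in> J"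
    "(\<lambda>n. \<psi> (T (\<tau> n) f)) \<longlonglongrightarrow> a"
  shows "\<psi> h \<le> a"
proof (rule field_le_epsilon)
  fix e :: real
  assume "e > 0"
  then obtain N where N: "\<And>t. t \<in> J \<Longrightarrow> N \<le> t \<Longrightarrow> \<psi> (pprt (h - T t f)) \<le> e"
    using lowerD[OF assms(1)] by blast
  have bound: "\<psi> h \<le> \<psi> (T t f) + e" if "t \<in> J" "N \<le> t" for t
  proof -
    have "h \<le> T t f + pprt (h - T t f)"
      using le_pprt[of "h - T t f"] by (simp add: algebra_simps)
    then have "\<psi> h \<le> \<psi> (T t f) + \<psi> (pprt (h - T t f))"
      using psi_mono by (metis blinfun.add_right)
    then show ?thesis
      using N[OF that] by simp
  qed
  have "\<forall>\<^sub>F n in sequentially. N \<le> \<tau> n"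
    using assms(2) by (simp add: filterlim_at_top)
  then have "\<forall>\<^sub>F n in sequentially. \<psi> h \<le> \<psi> (T (\<tau> n) f) + e"
    by eventually_elim (simp add: assms(3) bound)
  then show "\<psi> h \<le> a + e"
    by (intro tendsto_lowerbound[OF tendsto_add[OF assms(4) tendsto_const]]) auto
qed

text \<open>
  Lower bounds are closed under finite suprema and norm limits and lie in a common order
  interval, so an increasing sequence of lower bounds along which \<open>\<psi>\<close> approaches its supremum
  converges to the largest one.
\<close>

lemma greatest_lower:
  assumes "0 \<le> f" "f \<le> c *\<^sub>R u" "0 \<le> c"
  obtains g where "lower f g" "\<And>h. lower f h \<Longrightarrow> h \<le> g"
proof -
  define S where "S = \<psi> ` {h. lower f h}"
  have "S \<noteq> {}"
    using lower_zero[OF assms(1)] by (auto simp: S_def)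
  have bdd: "bdd_above S"
    using psi_mono[OF lower_le[OF _ assms(2,3)]]
    by (intro bdd_aboveI[of _ "\<psi> ((c * M) *\<^sub>R u)"]) (auto simp: S_def)
  have "\<exists>h. lower f h \<and> Sup S - inverse (real (Suc n)) < \<psi> h" for n
  proof -
    have "Sup S - inverse (real (Suc n)) < Sup S"
      by simp
    then show ?thesis
      unfolding less_cSup_iff[OF \<open>S \<noteq> {}\<close> bdd] by (auto simp: S_def)
  qed
  then obtain h where h: "\<And>n. lower f (h n)" "\<And>n. Sup S - inverse (real (Suc n)) < \<psi> (h n)"
    by metis
  \<comment> \<open>\<open>k j\<close> is the supremum of \<open>h 0, \<dots>, h j\<close>.\<close>
  define k where "k = rec_nat (h 0) (\<lambda>j y. sup y (h (Suc j)))"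
  have k0: "k 0 = h 0" and kSuc: "k (Suc j) = sup (k j) (h (Suc j))" for j
    by (simp_all add: k_def)
  have k_lower: "lower f (k n)" for n
    by (induction n) (auto simp: k0 kSuc h intro: lower_sup)
  have h_le_k: "h n \<le> k n" for n
    by (cases n) (auto simp: k0 kSuc)
  have "incseq k"
    by (rule incseq_SucI) (simp add: kSuc)
  then obtain g where g: "k \<longlonglongrightarrow> g" "\<And>n. k n \<le> g"
    by (rule increasing_order_bounded_convergent[OF oc _ lower_le[OF k_lower assms(2,3)]]) blast
  have g_lower: "lower f g"
    using k_lower g(1) by (rule lower_limit)
  have "Sup S \<le> \<psi> g"
  proof (rule tendsto_upperbound)
    show "(\<lambda>n. Sup S - inverse (real (Suc n))) \<longlonglongrightarrow> Sup S"
      using tendsto_diff[OF tendsto_const LIMSEQ_inverse_real_of_nat, of "Sup S"] by simp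
    have "\<psi> (h n) \<le> \<psi> g" for n
      using h_le_k g(2) by (intro psi_mono) (rule order_trans)
    then show "\<forall>\<^sub>F n in sequentially. Sup S - inverse (real (Suc n)) \<le> \<psi> g"
      using h(2) by (intro always_eventually allI) (meson less_imp_le order_trans)
  qed auto
  have "h' \<le> g" if h': "lower f h'" for h'
  proof -
    have "\<psi> (sup h' g) \<le> Sup S"
      using lower_sup[OF h' g_lower] bdd by (intro cSup_upper) (auto simp: S_def)
    with \<open>Sup S \<le> \<psi> g\<close> have "\<psi> (sup h' g - g) \<le> 0"
      by (simp add: blinfun.diff_right)
    then have "sup h' g - g = 0"
      by (intro psi_eq_0D) auto
    then show ?thesis
      by (metis eq_iff_diff_eq_0 sup.cobounded1)
  qed
  with g_lower show ?thesis
    by (rule that)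
qed

section \<open>The largest value along an orbit\<close>

text \<open>
  This functional replaces \<open>\<psi>\<close>, whose value may grow by the factor \<open>M\<close> under the semigroup: it does
  not increase along orbits and is at most \<open>M * \<psi>\<close> on the cone.
\<close>

definition orbit_sup :: "'a \<Rightarrow> real"
  where "orbit_sup x = (SUP t\<in>J. \<psi> (T t x))"

lemma psi_T_le_orbit_sup:
  assumes "t \<in> J" "0 \<le> x"
  shows "\<psi> (T t x) \<le> orbit_sup x"
  unfolding orbit_sup_def
  using assms psi_T_le[of _ x] by (intro cSUP_upper bdd_aboveI2[of _ _ "M * \<psi> x"]) auto

lemma orbit_sup_leI: "(\<And>t. t \<in> J \<Longrightarrow> \<psi> (T t x) \<le> a) \<Longrightarrow> orbit_sup x \<le> a"
  unfolding orbit_sup_def using J_unbounded by (intro cSUP_least) auto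

lemma orbit_sup_le: "0 \<le> x \<Longrightarrow> orbit_sup x \<le> M * \<psi> x"
  by (rule orbit_sup_leI) (rule psi_T_le)

lemma orbit_sup_nonneg:
  assumes "0 \<le> x"
  shows "0 \<le> orbit_sup x"
proof -
  obtain t where "t \<in> J"
    using J_unbounded by blast
  then have "0 \<le> \<psi> (T t x)"
    using assms by (intro psi_nonneg T_nonneg)
  also have "\<dots> \<le> orbit_sup x"
    using \<open>t \<in> J\<close> assms by (rule psi_T_le_orbit_sup)
  finally show ?thesis .
qed

lemma orbit_sup_mono:
  assumes "x \<le> y" "0 \<le> y"
  shows "orbit_sup x \<le> orbit_sup y"
proof (rule orbit_sup_leI)
  fix t
  assume t: "t \<in> J"
  then have "\<psi> (T t x) \<le> \<psi> (T t y)"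
    using assms(1) by (intro psi_mono T_mono)
  also have "\<dots> \<le> orbit_sup y"
    using t assms(2) by (rule psi_T_le_orbit_sup)
  finally show "\<psi> (T t x) \<le> orbit_sup y" .
qed

lemma orbit_sup_T:
  assumes "s \<in> J" "0 \<le> x"
  shows "orbit_sup (T s x) \<le> orbit_sup x"
proof (rule orbit_sup_leI)
  fix t
  assume t: "t \<in> J"
  then show "\<psi> (T t (T s x)) \<le> orbit_sup x"
    using psi_T_le_orbit_sup[OF J_add[OF t assms(1)] assms(2)] assms(1) by (simp add: T_add)
qed

lemma orbit_sup_add:
  assumes "0 \<le> x" "0 \<le> y"
  shows "orbit_sup (x + y) \<le> orbit_sup x + orbit_sup y"
  using assms
  by (intro orbit_sup_leI) (simp add: blinfun.add_right add_mono psi_T_le_orbit_sup)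

section \<open>From convergence on the principal ideal to strong convergence\<close>

definition orbit_Cauchy :: "'a \<Rightarrow> bool"
  where "orbit_Cauchy f \<longleftrightarrow>
    (\<forall>e>0. \<exists>N. \<forall>s\<in>J. \<forall>t\<in>J. N \<le> s \<and> N \<le> t \<longrightarrow> norm (T t f - T s f) < e)"

lemma T_norm_bound:
  obtains C where "C > 0" "\<And>t f. t \<in> J \<Longrightarrow> norm (T t f) \<le> C * norm f"
proof -
  obtain C where C: "C > 0" "\<And>t. t \<in> J \<Longrightarrow> norm (T t) \<le> C"
    using bounded_T by (auto simp: bounded_pos)
  have "norm (T t f) \<le> C * norm f" if "t \<in> J" for t f
  proof -
    have "norm (T t f) \<le> norm (T t) * norm f"
      by (rule norm_blinfun)
    also have "\<dots> \<le> C * norm f"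
      using C(2)[OF that] by (rule mult_right_mono) simp
    finally show ?thesis .
  qed
  with C(1) show ?thesis
    by (rule that)
qed

lemma orbit_Cauchy_diff:
  assumes "orbit_Cauchy f" "orbit_Cauchy g"
  shows "orbit_Cauchy (f - g)"
  unfolding orbit_Cauchy_def
proof (intro allI impI)
  fix e :: real
  assume "e > 0"
  then have "e / 2 > 0"
    by simp
  obtain N1 where N1: "\<And>s t. s \<in> J \<Longrightarrow> t \<in> J \<Longrightarrow> N1 \<le> s \<Longrightarrow> N1 \<le> t \<Longrightarrow> norm (T t f - T s f) < e / 2"
    using assms(1) \<open>e / 2 > 0\<close> unfolding orbit_Cauchy_def by meson
  obtain N2 where N2: "\<And>s t. s \<in> J \<Longrightarrow> t \<in> J \<Longrightarrow> N2 \<le> s \<Longrightarrow> N2 \<le> t \<Longrightarrow> norm (T t g - T s g) < e / 2"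
    using assms(2) \<open>e / 2 > 0\<close> unfolding orbit_Cauchy_def by meson
  have "norm (T t (f - g) - T s (f - g)) < e"
    if "s \<in> J" "t \<in> J" "max N1 N2 \<le> s" "max N1 N2 \<le> t" for s t
  proof -
    have "T t (f - g) - T s (f - g) = (T t f - T s f) - (T t g - T s g)"
      by (simp add: blinfun.diff_right)
    then show ?thesis
      using norm_triangle_ineq4[of "T t f - T s f" "T t g - T s g"] N1[of s t] N2[of s t] that
      by simp
  qed
  then show "\<exists>N. \<forall>s\<in>J. \<forall>t\<in>J. N \<le> s \<and> N \<le> t \<longrightarrow> norm (T t (f - g) - T s (f - g)) < e"
    by blast
qed

lemma orbit_Cauchy_closure:
  assumes "f \<in> closure A" "\<And>g. g \<in> A \<Longrightarrow> orbit_Cauchy g"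
  shows "orbit_Cauchy f"
  unfolding orbit_Cauchy_def
proof (intro allI impI)
  fix e :: real
  assume "e > 0"
  obtain C where C: "C > 0" "\<And>t f. t \<in> J \<Longrightarrow> norm (T t f) \<le> C * norm f"
    using T_norm_bound by blast
  have "e / (3 * C) > 0" "e / 3 > 0"
    using \<open>e > 0\<close> C(1) by auto
  then obtain g where g: "g \<in> A" "norm (f - g) < e / (3 * C)"
    using assms(1) by (metis closure_approachable dist_norm norm_minus_commute)
  have near: "norm (T t (f - g)) < e / 3" if "t \<in> J" for t
  proof -
    have "norm (T t (f - g)) \<le> C * norm (f - g)"
      using C(2)[OF that] .
    also have "\<dots> < C * (e / (3 * C))"
      using g(2) C(1) by (rule mult_strict_left_mono)
    also have "\<dots> = e / 3"
      using C(1) by simp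
    finally show ?thesis .
  qed
  obtain N where N: "\<And>s t. s \<in> J \<Longrightarrow> t \<in> J \<Longrightarrow> N \<le> s \<Longrightarrow> N \<le> t \<Longrightarrow> norm (T t g - T s g) < e / 3"
    using assms(2)[OF g(1)] \<open>e / 3 > 0\<close> unfolding orbit_Cauchy_def by meson
  have "norm (T t f - T s f) < e" if "s \<in> J" "t \<in> J" "N \<le> s" "N \<le> t" for s t
  proof -
    have "T t f - T s f = T t (f - g) - T s (f - g) + (T t g - T s g)"
      by (simp add: blinfun.diff_right)
    then have "norm (T t f - T s f) \<le> norm (T t (f - g)) + norm (T s (f - g)) + norm (T t g - T s g)"
      using norm_triangle_ineq[of "T t (f - g) - T s (f - g)" "T t g - T s g"]
        norm_triangle_ineq4[of "T t (f - g)" "T s (f - g)"] by simp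
    then show ?thesis
      using near[OF that(1)] near[OF that(2)] N[OF that] by simp
  qed
  then show "\<exists>N. \<forall>s\<in>J. \<forall>t\<in>J. N \<le> s \<and> N \<le> t \<longrightarrow> norm (T t f - T s f) < e"
    by blast
qed

lemma orbit_Cauchy_convergent:
  assumes "orbit_Cauchy f"
  shows "\<exists>l. ((\<lambda>t. T t f) \<longlongrightarrow> l) (at_top_within J)"
proof -
  define x where "x n = T (real (Suc n)) f" for n
  have xJ: "real (Suc n) \<in> J" for n
    by (rule J_of_nat) simp
  have "Cauchy x"
  proof (rule CauchyI)
    fix e :: real
    assume "0 < e"
    then obtain N where N: "\<And>s t. s \<in> J \<Longrightarrow> t \<in> J \<Longrightarrow> N \<le> s \<Longrightarrow> N \<le> t \<Longrightarrow> norm (T t f - T s f) < e"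
      using assms unfolding orbit_Cauchy_def by meson
    obtain K where K: "N \<le> real K"
      using real_arch_simple by blast
    have "norm (x m - x n) < e" if "K \<le> m" "K \<le> n" for m n
      unfolding x_def using K that by (intro N xJ) auto
    then show "\<exists>K. \<forall>m\<ge>K. \<forall>n\<ge>K. norm (x m - x n) < e"
      by blast
  qed
  then obtain l where l: "x \<longlonglongrightarrow> l"
    using Cauchy_convergent_iff convergent_def by blast
  have "((\<lambda>t. T t f) \<longlongrightarrow> l) (at_top_within J)"
  proof (rule tendstoI)
    fix e :: real
    assume "0 < e"
    then have "e / 2 > 0"
      by simp
    then obtain N where N: "\<And>s t. s \<in> J \<Longrightarrow> t \<in> J \<Longrightarrow> N \<le> s \<Longrightarrow> N \<le> t \<Longrightarrow> norm (T t f - T s f) < e / 2"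
      using assms unfolding orbit_Cauchy_def by meson
    obtain K where K: "N \<le> real K"
      using real_arch_simple by blast
    obtain K' where K': "\<And>n. n \<ge> K' \<Longrightarrow> norm (x n - l) < e / 2"
      using LIMSEQ_D[OF l \<open>e / 2 > 0\<close>] by blast
    have "dist (T t f) l < e" if "t \<in> J" "N \<le> t" for t
    proof -
      have "norm (T t f - x (max K K')) < e / 2"
        unfolding x_def using K that by (intro N xJ) auto
      moreover have "norm (x (max K K') - l) < e / 2"
        by (rule K') simp
      ultimately show ?thesis
        using norm_triangle_ineq[of "T t f - x (max K K')" "x (max K K') - l"]
        by (simp add: dist_norm)
    qed
    then show "\<forall>\<^sub>F t in at_top_within J. dist (T t f) l < e"
      by (auto simp: eventually_at_top_within)
  qed
  then show ?thesis
    by blast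
qed

lemma strong_convergence_if_orbit_Cauchy:
  assumes "\<And>f c. 0 \<le> f \<Longrightarrow> 0 \<le> c \<Longrightarrow> f \<le> c *\<^sub>R u \<Longrightarrow> orbit_Cauchy f"
  obtains P where "converges_strongly_to J T P"
proof -
  have "orbit_Cauchy g" if g: "g \<in> principal_ideal u" for g
  proof -
    obtain c where c: "c > 0" "\<bar>g\<bar> \<le> c *\<^sub>R u"
      using g by (auto simp: principal_ideal_def)
    have "orbit_Cauchy (pprt g)"
      using c pprt_le_abs[of g] by (intro assms[of _ c]) (auto intro: order_trans)
    moreover have "orbit_Cauchy (pprt (- g))"
      using c pprt_le_abs[of "- g"] by (intro assms[of _ c]) (auto intro: order_trans)
    ultimately have "orbit_Cauchy (pprt g - pprt (- g))"
      by (rule orbit_Cauchy_diff)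
    then show ?thesis
      by (simp only: pprt_diff_uminus)
  qed
  moreover have "f \<in> closure (principal_ideal u)" for f
    using quasi_interior by (simp add: quasi_interior_def)
  ultimately have "orbit_Cauchy f" for f
    using orbit_Cauchy_closure by blast
  then have "\<exists>L. \<forall>f. ((\<lambda>t. T t f) \<longlongrightarrow> L f) (at_top_within J)"
    using orbit_Cauchy_convergent by (intro choice) blast
  then obtain L where L: "\<And>f. ((\<lambda>t. T t f) \<longlongrightarrow> L f) (at_top_within J)"
    by blast
  obtain C where C: "C > 0" "\<And>t f. t \<in> J \<Longrightarrow> norm (T t f) \<le> C * norm f"
    using T_norm_bound by blast
  have "bounded_linear L"
  proof (rule bounded_linear_intro[where K = C])
    fix f g :: 'a and r :: real
    have "((\<lambda>t. T t (f + g)) \<longlongrightarrow> L f + L g) (at_top_within J)"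
      unfolding blinfun.add_right by (intro tendsto_add L)
    then show "L (f + g) = L f + L g"
      using L tendsto_unique[OF at_top_within_nontrivial] by blast
    have "((\<lambda>t. T t (r *\<^sub>R f)) \<longlongrightarrow> r *\<^sub>R L f) (at_top_within J)"
      unfolding blinfun.scaleR_right by (intro tendsto_scaleR tendsto_const L)
    then show "L (r *\<^sub>R f) = r *\<^sub>R L f"
      using L tendsto_unique[OF at_top_within_nontrivial] by blast
    have "\<forall>\<^sub>F t in at_top_within J. norm (T t f) \<le> norm f * C"
      using C(2)[of _ f] by (auto simp: eventually_at_top_within mult.commute)
    then show "norm (L f) \<le> norm f * C"
      by (rule tendsto_upperbound[OF tendsto_norm[OF L] _ at_top_within_nontrivial])
  qed
  then have "converges_strongly_to J T (Blinfun L)"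
    using L by (simp add: converges_strongly_to_def bounded_linear_Blinfun_apply)
  then show ?thesis
    by (rule that)
qed

end

section \<open>Uniform lower bounds force convergence\<close>

locale uniformly_bounded_below = dominated_semigroup +
  fixes \<epsilon> :: real
  assumes eps_pos: "\<epsilon> > 0"
    and uniform_lower: "0 \<le> f \<Longrightarrow> \<exists>h. lower f h \<and> \<epsilon> * \<psi> f \<le> \<psi> h"
begin

text \<open>
  The image of a lower bound is a lower bound, so the greatest lower bound \<open>g\<close> satisfies
  \<open>T t g \<le> g\<close> and its orbit decreases to a fixed vector. A second use of the hypothesis, now for
  \<open>g\<close> in place of \<open>f\<close>, shows that \<open>\<psi>\<close> loses at most another factor \<open>\<epsilon>\<close> along the way.
\<close>

lemma invariant_lower:
  assumes "0 \<le> f" "f \<le> c *\<^sub>R u" "0 \<le> c"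
  obtains k where "lower f k" "\<And>t. t \<in> J \<Longrightarrow> T t k = k" "\<epsilon>\<^sup>2 * \<psi> f \<le> \<psi> k"
proof -
  obtain g where g: "lower f g" "\<And>h. lower f h \<Longrightarrow> h \<le> g"
    using greatest_lower[OF assms] by blast
  have g_nonneg: "0 \<le> g"
    using g(1) by (rule lower_nonneg)
  have T_g_le: "T t g \<le> g" if "t \<in> J" for t
    using lower_T[OF g(1) that] by (rule g(2))
  have dec: "T (t + s) g \<le> T t g" if "s \<in> J" "t \<in> J" for s t
    using T_mono[OF that(2) T_g_le[OF that(1)]] that by (simp add: T_add)
  define \<tau> where "\<tau> n = real (Suc n)" for n
  have \<tau>J: "\<tau> n \<in> J" for n
    unfolding \<tau>_def by (rule J_of_nat) simp
  have "decseq (\<lambda>n. T (\<tau> n) g)"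
  proof (rule decseq_SucI)
    fix n
    have "\<tau> (Suc n) = \<tau> n + \<tau> 0"
      by (simp add: \<tau>_def)
    then show "T (\<tau> (Suc n)) g \<le> T (\<tau> n) g"
      using dec[OF \<tau>J \<tau>J] by simp
  qed
  then obtain k where k: "(\<lambda>n. T (\<tau> n) g) \<longlonglongrightarrow> k" "\<And>n. k \<le> T (\<tau> n) g"
    by (rule decreasing_nonneg_convergent[OF oc]) (use T_nonneg[OF \<tau>J g_nonneg] in blast)+
  have "lower f k"
    using lower_T[OF g(1) \<tau>J] k(1) by (rule lower_limit)
  moreover have "T s k = k" if s: "s \<in> J" for s
  proof (rule antisym)
    have lim: "(\<lambda>n. T s (T (\<tau> n) g)) \<longlonglongrightarrow> T s k"
      by (intro tendsto_intros k)
    have eq: "T s (T (\<tau> n) g) = T (\<tau> n + s) g" for n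
      using T_add[OF \<tau>J s] by (simp add: add.commute)
    show "T s k \<le> k"
      by (rule tendsto_le_lattice[OF lim k(1)]) (use dec[OF s \<tau>J] in \<open>simp_all add: eq\<close>)
    \<comment> \<open>A later integer time bounds \<open>T (\<tau> n + s) g\<close> from below.\<close>
    obtain m where m: "s < real m"
      using reals_Archimedean2 by blast
    have "k \<le> T (\<tau> n + s) g" for n
    proof -
      have "real m - s \<in> J"
        using m J_pos[OF s] by (intro J_diff s J_of_nat) auto
      then have "T ((\<tau> n + s) + (real m - s)) g \<le> T (\<tau> n + s) g"
        using dec J_add[OF \<tau>J s] by blast
      moreover have "(\<tau> n + s) + (real m - s) = \<tau> (n + m)"
        by (simp add: \<tau>_def)
      ultimately show ?thesis
        using k(2)[of "n + m"] by simp
    qed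
    then show "k \<le> T s k"
      by (intro tendsto_le_lattice[OF tendsto_const lim]) (simp_all add: eq)
  qed
  moreover have "\<epsilon>\<^sup>2 * \<psi> f \<le> \<psi> k"
  proof -
    obtain h where h: "lower f h" "\<epsilon> * \<psi> f \<le> \<psi> h"
      using uniform_lower[OF assms(1)] by blast
    obtain h' where h': "lower g h'" "\<epsilon> * \<psi> g \<le> \<psi> h'"
      using uniform_lower[OF g_nonneg] by blast
    have "filterlim \<tau> at_top sequentially"
      unfolding \<tau>_def
      using filterlim_compose[OF filterlim_real_sequentially filterlim_Suc] by simp
    moreover have "(\<lambda>n. \<psi> (T (\<tau> n) g)) \<longlonglongrightarrow> \<psi> k"
      by (intro tendsto_intros k)
    ultimately have "\<psi> h' \<le> \<psi> k"
      using psi_lower_le_limit[OF h'(1)] \<tau>J by blast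
    moreover have "\<epsilon> * (\<epsilon> * \<psi> f) \<le> \<epsilon> * \<psi> g"
      using h(2) psi_mono[OF g(2)[OF h(1)]] eps_pos by (intro mult_left_mono) auto
    ultimately show ?thesis
      using h'(2) by (simp add: power2_eq_square)
  qed
  ultimately show ?thesis
    by (rule that)
qed

text \<open>The maximum makes powers of the factor nonnegative, also on the zero space, where \<open>\<epsilon>\<close> can be arbitrarily large.\<close>

definition contraction :: real
  where "contraction = max 0 (1 - \<epsilon>\<^sup>2 / M)"

lemma contraction_bounds: "0 \<le> contraction" "contraction < 1"
  using eps_pos M_pos by (auto simp: contraction_def)

text \<open>
  With \<open>k\<close> fixed, \<open>T s (T t f - k)\<^sup>+ = T (s + t) f - k + T s r\<close> where \<open>r = (k - T t f)\<^sup>+\<close>. So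
  \<open>\<psi> k\<close> is subtracted from \<open>\<psi>\<close> along the entire orbit, and \<open>\<psi> k \<ge> \<epsilon>\<^sup>2 \<psi> f\<close> is at least the
  fraction \<open>\<epsilon>\<^sup>2 / M\<close> of \<open>orbit_sup f\<close>.
\<close>

lemma contraction_step:
  assumes "0 \<le> f" "f \<le> c *\<^sub>R u" "0 \<le> c" "\<eta> > 0"
  obtains t k where "t \<in> J" "0 \<le> k" "\<And>s. s \<in> J \<Longrightarrow> T s k = k"
    "orbit_sup (pprt (T t f - k)) \<le> contraction * orbit_sup f + \<eta>"
    "orbit_sup (pprt (k - T t f)) \<le> \<eta>"
proof -
  obtain k where k: "lower f k" "\<And>t. t \<in> J \<Longrightarrow> T t k = k" "\<epsilon>\<^sup>2 * \<psi> f \<le> \<psi> k"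
    using invariant_lower[OF assms(1-3)] by blast
  have "\<eta> / M > 0"
    using assms(4) M_pos by simp
  then obtain N where N: "\<And>t. t \<in> J \<Longrightarrow> N \<le> t \<Longrightarrow> \<psi> (pprt (k - T t f)) \<le> \<eta> / M"
    using lowerD[OF k(1)] by blast
  obtain t where t: "t \<in> J" "N \<le> t"
    using J_unbounded by blast
  define r where "r = pprt (k - T t f)"
  have r_nonneg: "0 \<le> r"
    by (simp add: r_def)
  have "orbit_sup r \<le> M * \<psi> r"
    using r_nonneg by (rule orbit_sup_le)
  also have "\<dots> \<le> M * (\<eta> / M)"
    using N[OF t] M_pos by (intro mult_left_mono) (auto simp: r_def)
  finally have r: "orbit_sup r \<le> \<eta>"
    using M_pos by simp
  have pos: "pprt (T t f - k) = T t f - k + r"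
    using pprt_diff_uminus[of "T t f - k"] by (simp add: r_def algebra_simps)
  have "orbit_sup f \<le> M * \<psi> f"
    using assms(1) by (rule orbit_sup_le)
  then have "(\<epsilon>\<^sup>2 / M) * orbit_sup f \<le> (\<epsilon>\<^sup>2 / M) * (M * \<psi> f)"
    using M_pos by (intro mult_left_mono) auto
  with k(3) have psi_k: "(\<epsilon>\<^sup>2 / M) * orbit_sup f \<le> \<psi> k"
    using M_pos by simp
  have "orbit_sup (pprt (T t f - k)) \<le> (1 - \<epsilon>\<^sup>2 / M) * orbit_sup f + \<eta>"
  proof (rule orbit_sup_leI)
    fix s
    assume s: "s \<in> J"
    have "T s (pprt (T t f - k)) = T (s + t) f - k + T s r"
      using T_add[OF t(1) s] k(2)[OF s] by (simp add: pos blinfun.add_right blinfun.diff_right)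
    then have "\<psi> (T s (pprt (T t f - k))) = \<psi> (T (s + t) f) - \<psi> k + \<psi> (T s r)"
      by (simp add: blinfun.add_right blinfun.diff_right)
    moreover have "\<psi> (T (s + t) f) \<le> orbit_sup f"
      using J_add[OF s t(1)] assms(1) by (rule psi_T_le_orbit_sup)
    moreover have "\<psi> (T s r) \<le> \<eta>"
      using psi_T_le_orbit_sup[OF s r_nonneg] r by simp
    ultimately show "\<psi> (T s (pprt (T t f - k))) \<le> (1 - \<epsilon>\<^sup>2 / M) * orbit_sup f + \<eta>"
      using psi_k by (simp add: algebra_simps)
  qed
  also have "\<dots> \<le> contraction * orbit_sup f + \<eta>"
    using orbit_sup_nonneg[OF assms(1)]
    by (intro add_right_mono mult_right_mono) (auto simp: contraction_def)
  finally show ?thesis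
    using that[OF t(1) lower_nonneg[OF k(1)] k(2)] r by (simp add: r_def)
qed

text \<open>
  The positive part \<open>f'\<close> remaining after \<open>n\<close> steps is again dominated by a multiple of \<open>u\<close>, so a
  further fixed vector can be split off from it; the sum of the fixed vectors is fixed. The
  negative parts are measured by \<open>orbit_sup\<close> as well, so that moving an earlier one forward in time
  costs no factor \<open>M\<close> and the errors merely add up.
\<close>

lemma iterated_contraction:
  assumes "0 \<le> f" "f \<le> c *\<^sub>R u" "0 \<le> c" "\<eta> > 0"
  shows "\<exists>t k. t \<in> J \<and> 0 \<le> k \<and> (\<forall>s\<in>J. T s k = k) \<and>
    orbit_sup (pprt (T t f - k)) \<le> contraction ^ n * orbit_sup f + \<eta> \<and>
    orbit_sup (pprt (k - T t f)) \<le> \<eta>"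
  using assms(4)
proof (induction n arbitrary: \<eta>)
  case 0
  have one: "1 \<in> J"
    using J_of_nat[of 1] by simp
  have nonneg: "0 \<le> T 1 f"
    using one assms(1) by (rule T_nonneg)
  have "orbit_sup 0 \<le> \<eta>"
    using 0 by (intro orbit_sup_leI) simp
  with one nonneg orbit_sup_T[OF one assms(1)] 0 show ?case
    by (intro exI[of _ 1] exI[of _ 0]) simp
next
  case (Suc n)
  have "\<eta> / 2 > 0"
    using Suc.prems by simp
  obtain t k where t: "t \<in> J" and k: "0 \<le> k" "\<And>s. s \<in> J \<Longrightarrow> T s k = k"
    and pos: "orbit_sup (pprt (T t f - k)) \<le> contraction ^ n * orbit_sup f + \<eta> / 2"
    and neg: "orbit_sup (pprt (k - T t f)) \<le> \<eta> / 2"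
    using Suc.IH[OF \<open>\<eta> / 2 > 0\<close>] by blast
  define f' where "f' = pprt (T t f - k)"
  define r where "r = pprt (k - T t f)"
  have f'_nonneg: "0 \<le> f'" and r_nonneg: "0 \<le> r"
    by (simp_all add: f'_def r_def)
  have "f' \<le> T t f"
    using k(1) T_nonneg[OF t assms(1)] by (simp add: f'_def pprt_le_iff)
  also have "\<dots> \<le> (c * M) *\<^sub>R u"
    using t assms(2,3) by (rule T_le_scaled_u)
  finally have f'_le: "f' \<le> (c * M) *\<^sub>R u" .
  have "0 \<le> c * M"
    using assms(3) M_pos by simp
  obtain t' k' where t': "t' \<in> J" and k': "0 \<le> k'" "\<And>s. s \<in> J \<Longrightarrow> T s k' = k'"
    and pos': "orbit_sup (pprt (T t' f' - k')) \<le> contraction * orbit_sup f' + \<eta> / 2"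
    and neg': "orbit_sup (pprt (k' - T t' f')) \<le> \<eta> / 2"
    using contraction_step[OF f'_nonneg f'_le \<open>0 \<le> c * M\<close> \<open>\<eta> / 2 > 0\<close>] by blast
  have T_r_nonneg: "0 \<le> T t' r"
    using t' r_nonneg by (rule T_nonneg)
  have "T t f - k = f' - r"
    using pprt_diff_uminus[of "T t f - k"] by (simp add: f'_def r_def)
  then have "T t' (T t f - k) = T t' (f' - r)"
    by simp
  then have split: "T (t' + t) f - (k + k') = T t' f' - k' - T t' r"
    using T_add[OF t t'] k(2)[OF t'] by (simp add: blinfun.diff_right algebra_simps)
  have "pprt (T (t' + t) f - (k + k')) \<le> pprt (T t' f' - k')"
    using T_r_nonneg unfolding split by (intro pprt_mono) simp
  then have "orbit_sup (pprt (T (t' + t) f - (k + k'))) \<le> orbit_sup (pprt (T t' f' - k'))"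
    by (rule orbit_sup_mono) simp
  also have "\<dots> \<le> contraction * orbit_sup f' + \<eta> / 2"
    by (rule pos')
  also have "\<dots> \<le> contraction * (contraction ^ n * orbit_sup f + \<eta> / 2) + \<eta> / 2"
    using pos contraction_bounds by (intro add_right_mono mult_left_mono) (auto simp: f'_def)
  also have "\<dots> \<le> contraction ^ Suc n * orbit_sup f + \<eta>"
  proof -
    have "contraction * (\<eta> / 2) \<le> 1 * (\<eta> / 2)"
      using contraction_bounds Suc.prems by (intro mult_right_mono) auto
    then show ?thesis
      by (simp add: distrib_left)
  qed
  finally have A: "orbit_sup (pprt (T (t' + t) f - (k + k'))) \<le> contraction ^ Suc n * orbit_sup f + \<eta>" .
  have "k + k' - T (t' + t) f = (k' - T t' f') + T t' r"
    using split by (simp add: algebra_simps)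
  also have "\<dots> \<le> pprt (k' - T t' f') + T t' r"
    by (intro add_right_mono le_pprt)
  finally have "pprt (k + k' - T (t' + t) f) \<le> pprt (k' - T t' f') + T t' r"
    using T_r_nonneg by (simp add: pprt_le_iff)
  then have "orbit_sup (pprt (k + k' - T (t' + t) f)) \<le> orbit_sup (pprt (k' - T t' f') + T t' r)"
    using T_r_nonneg by (intro orbit_sup_mono) auto
  also have "\<dots> \<le> orbit_sup (pprt (k' - T t' f')) + orbit_sup (T t' r)"
    using T_r_nonneg by (intro orbit_sup_add) auto
  also have "\<dots> \<le> \<eta> / 2 + \<eta> / 2"
    using neg' orbit_sup_T[OF t' r_nonneg] neg by (intro add_mono) (auto simp: r_def)
  finally have B: "orbit_sup (pprt (k + k' - T (t' + t) f)) \<le> \<eta>"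
    by simp
  have "\<forall>s\<in>J. T s (k + k') = k + k'"
    using k(2) k'(2) by (simp add: blinfun.add_right)
  then show ?case
    using A B J_add[OF t' t] k(1) k'(1)
    by (intro exI[of _ "t' + t"] exI[of _ "k + k'"]) auto
qed

text \<open>
  Once \<open>T s f\<close> is close to a fixed vector for one \<open>s\<close>, all later \<open>T t f\<close> are, since
  \<open>T t f - k = T (t - s) (T s f - k)\<close> and \<open>orbit_sup\<close> bounds the whole orbit of the difference.
\<close>

lemma orbit_approximately_invariant:
  assumes "0 \<le> f" "f \<le> c *\<^sub>R u" "0 \<le> c" "e > 0"
  obtains N k where "\<And>t. t \<in> J \<Longrightarrow> N \<le> t \<Longrightarrow> \<psi> \<bar>T t f - k\<bar> \<le> e"
proof -
  have "(\<lambda>n. contraction ^ n * orbit_sup f) \<longlonglongrightarrow> 0"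
    using contraction_bounds by (intro tendsto_mult_left_zero LIMSEQ_realpow_zero)
  then have "\<forall>\<^sub>F n in sequentially. contraction ^ n * orbit_sup f < e / 3"
    using assms(4) by (intro order_tendstoD(2)) auto
  then obtain n where n: "contraction ^ n * orbit_sup f < e / 3"
    by (auto simp: eventually_sequentially)
  have "e / 3 > 0"
    using assms(4) by simp
  obtain s k where s: "s \<in> J" and k: "\<And>t. t \<in> J \<Longrightarrow> T t k = k"
    and pos: "orbit_sup (pprt (T s f - k)) \<le> contraction ^ n * orbit_sup f + e / 3"
    and neg: "orbit_sup (pprt (k - T s f)) \<le> e / 3"
    using iterated_contraction[OF assms(1-3) \<open>e / 3 > 0\<close>, of n] by blast
  have "\<psi> \<bar>T t f - k\<bar> \<le> e" if t: "t \<in> J" "s + 1 \<le> t" for t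
  proof -
    have ts: "t - s \<in> J"
      using s t by (simp add: J_diff)
    let ?a = "pprt (T s f - k)" and ?b = "pprt (k - T s f)"
    have nonneg: "0 \<le> T (t - s) ?a" "0 \<le> T (t - s) ?b"
      using ts by (auto intro: T_nonneg)
    have "T t f - k = T (t - s) (T s f - k)"
      using T_add[OF s ts] k[OF ts] by (simp add: blinfun.diff_right)
    also have "T s f - k = ?a - ?b"
      using pprt_diff_uminus[of "T s f - k"] by simp
    finally have "T t f - k = T (t - s) ?a - T (t - s) ?b"
      by (simp add: blinfun.diff_right)
    then have "\<bar>T t f - k\<bar> \<le> T (t - s) ?a + T (t - s) ?b"
      using abs_triangle_ineq4[of "T (t - s) ?a" "T (t - s) ?b"] nonneg by (simp add: abs_of_nonneg)
    then have "\<psi> \<bar>T t f - k\<bar> \<le> \<psi> (T (t - s) ?a) + \<psi> (T (t - s) ?b)"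
      using psi_mono by (metis blinfun.add_right)
    also have "\<dots> \<le> orbit_sup ?a + orbit_sup ?b"
      using ts by (intro add_mono psi_T_le_orbit_sup) auto
    finally show ?thesis
      using pos neg n by simp
  qed
  then show ?thesis
    by (rule that)
qed

lemma orbit_Cauchy_on_principal_ideal:
  assumes "0 \<le> f" "0 \<le> c" "f \<le> c *\<^sub>R u"
  shows "orbit_Cauchy f"
  unfolding orbit_Cauchy_def
proof (intro allI impI)
  fix e :: real
  assume "e > 0"
  then obtain \<delta> where \<delta>: "\<delta> > 0"
    "\<And>x. \<bar>x\<bar> \<le> (c * M) *\<^sub>R u \<Longrightarrow> \<psi> \<bar>x\<bar> \<le> \<delta> \<Longrightarrow> norm x < e"
    using norm_small_if_functional_small[OF oc strictly_positive] by metis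
  then have "\<delta> / 2 > 0"
    by simp
  then obtain N k where N: "\<And>t. t \<in> J \<Longrightarrow> N \<le> t \<Longrightarrow> \<psi> \<bar>T t f - k\<bar> \<le> \<delta> / 2"
    using orbit_approximately_invariant[OF assms(1,3,2)] by blast
  have "norm (T t f - T s f) < e" if "s \<in> J" "t \<in> J" "N \<le> s" "N \<le> t" for s t
  proof (rule \<delta>(2))
    have range: "0 \<le> T r f" "T r f \<le> (c * M) *\<^sub>R u" if "r \<in> J" for r
      using that assms by (auto intro: T_nonneg T_le_scaled_u)
    show "\<bar>T t f - T s f\<bar> \<le> (c * M) *\<^sub>R u"
    proof (rule abs_leI)
      show "T t f - T s f \<le> (c * M) *\<^sub>R u"
        using diff_mono[OF range(2)[OF that(2)] range(1)[OF that(1)]] by simp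
      show "- (T t f - T s f) \<le> (c * M) *\<^sub>R u"
        using diff_mono[OF range(2)[OF that(1)] range(1)[OF that(2)]] by simp
    qed
    have "\<bar>T t f - T s f\<bar> \<le> \<bar>T t f - k\<bar> + \<bar>T s f - k\<bar>"
      using abs_triangle_ineq4[of "T t f - k" "T s f - k"] by simp
    then have "\<psi> \<bar>T t f - T s f\<bar> \<le> \<psi> \<bar>T t f - k\<bar> + \<psi> \<bar>T s f - k\<bar>"
      using psi_mono by (metis blinfun.add_right)
    then show "\<psi> \<bar>T t f - T s f\<bar> \<le> \<delta>"
      using N[of s] N[of t] that by simp
  qed
  then show "\<exists>N. \<forall>s\<in>J. \<forall>t\<in>J. N \<le> s \<and> N \<le> t \<longrightarrow> norm (T t f - T s f) < e"
    by blast
qed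

lemma strong_convergence:
  "\<exists>P. converges_strongly_to J T P \<and> dual_le (\<epsilon> *\<^sub>R \<psi>) (dual_op P \<psi>)"
proof -
  obtain P where P: "converges_strongly_to J T P"
    by (rule strong_convergence_if_orbit_Cauchy[OF orbit_Cauchy_on_principal_ideal])
  have "\<epsilon> * \<psi> f \<le> \<psi> (P f)" if f: "0 \<le> f" for f
  proof -
    obtain h where h: "lower f h" "\<epsilon> * \<psi> f \<le> \<psi> h"
      using uniform_lower[OF f] by blast
    have "((\<lambda>t. \<psi> (T t f) + \<psi> (pprt (h - T t f))) \<longlongrightarrow> \<psi> (P f) + 0) (at_top_within J)"
      using P h(1) unfolding converges_strongly_to_def lower_iff_tendsto
      by (intro tendsto_add bounded_linear.tendsto[OF blinfun.bounded_linear_right]) auto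
    moreover have "\<psi> h \<le> \<psi> (T t f) + \<psi> (pprt (h - T t f))" for t
    proof -
      have "h \<le> T t f + pprt (h - T t f)"
        using le_pprt[of "h - T t f"] by (simp add: algebra_simps)
      then show ?thesis
        using psi_mono by (metis blinfun.add_right)
    qed
    ultimately have "\<psi> h \<le> \<psi> (P f) + 0"
      by (intro tendsto_lowerbound[OF _ _ at_top_within_nontrivial]) auto
    with h(2) show ?thesis
      by simp
  qed
  then have "dual_le (\<epsilon> *\<^sub>R \<psi>) (dual_op P \<psi>)"
    by (simp add: dual_le_def dual_op_def blinfun.scaleR_left)
  with P show ?thesis
    by blast
qed

end

section \<open>The characterisation\<close>

lemma (in dominated_semigroup) uniform_lower_if_normalised:
  assumes h: "\<And>f. 0 \<le> f \<Longrightarrow> \<psi> f = 1 \<Longrightarrow> lower f (h f) \<and> \<epsilon> \<le> \<psi> (h f)" and f: "0 \<le> f"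
  shows "\<exists>h. lower f h \<and> \<epsilon> * \<psi> f \<le> \<psi> h"
proof (cases "f = 0")
  case True
  then show ?thesis
    using lower_zero[of 0] by (intro exI[of _ 0]) simp
next
  case False
  define a where "a = \<psi> f"
  have a: "a > 0"
    using strictly_positive f False by (simp add: a_def strictly_positive_def)
  define g where "g = inverse a *\<^sub>R f"
  have "0 \<le> g"
    using a f by (simp add: g_def scaleR_nonneg_nonneg)
  moreover have "\<psi> g = 1"
    using a by (simp add: g_def blinfun.scaleR_right flip: a_def)
  ultimately have hg: "lower g (h g)" "\<epsilon> \<le> \<psi> (h g)"
    using h by auto
  have f_eq: "f = a *\<^sub>R g"
    using a by (simp add: g_def)
  have "lower f (a *\<^sub>R h g)"
  proof (rule lowerI)
    show "0 \<le> a *\<^sub>R h g"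
      using a lower_nonneg[OF hg(1)] by (simp add: scaleR_nonneg_nonneg)
    fix e :: real
    assume "e > 0"
    then have "e / a > 0"
      using a by simp
    then obtain N where N: "\<And>t. t \<in> J \<Longrightarrow> N \<le> t \<Longrightarrow> \<psi> (pprt (h g - T t g)) \<le> e / a"
      using lowerD[OF hg(1)] by blast
    have "\<psi> (pprt (a *\<^sub>R h g - T t f)) \<le> e" if "t \<in> J" "N \<le> t" for t
    proof -
      have "a *\<^sub>R h g - T t f = a *\<^sub>R (h g - T t g)"
        by (simp add: f_eq blinfun.scaleR_right scaleR_diff_right)
      also have "\<dots> \<le> a *\<^sub>R pprt (h g - T t g)"
        using a by (intro scaleR_left_mono le_pprt) auto
      finally have "pprt (a *\<^sub>R h g - T t f) \<le> a *\<^sub>R pprt (h g - T t g)"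
        using a by (simp add: pprt_le_iff scaleR_nonneg_nonneg)
      then have "\<psi> (pprt (a *\<^sub>R h g - T t f)) \<le> a * \<psi> (pprt (h g - T t g))"
        using psi_mono by (metis blinfun.scaleR_right real_scaleR_def)
      also have "\<dots> \<le> a * (e / a)"
        using N[OF that] a by (intro mult_left_mono) auto
      finally show ?thesis
        using a by simp
    qed
    then show "\<exists>N. \<forall>t\<in>J. N \<le> t \<longrightarrow> \<psi> (pprt (a *\<^sub>R h g - T t f)) \<le> e"
      by blast
  qed
  moreover have "\<epsilon> * \<psi> f \<le> \<psi> (a *\<^sub>R h g)"
    using mult_left_mono[OF hg(2), of a] a
    by (simp add: blinfun.scaleR_right mult.commute flip: a_def)
  ultimately show ?thesis
    by blast
qed

lemma (in dominated_semigroup) limit_lower: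
  assumes P: "converges_strongly_to J T P" and f: "0 \<le> f"
  shows "lower f (P f)"
  unfolding lower_iff_tendsto
proof
  have lim: "((\<lambda>t. T t f) \<longlongrightarrow> P f) (at_top_within J)"
    using P by (simp add: converges_strongly_to_def)
  have "\<forall>\<^sub>F t in at_top_within J. 0 \<le> T t f"
    using T_nonneg f by (auto simp: eventually_at_top_within)
  then show "0 \<le> P f"
    by (rule tendsto_nonneg[OF lim at_top_within_nontrivial])
  show "((\<lambda>t. \<psi> (pprt (P f - T t f))) \<longlongrightarrow> 0) (at_top_within J)"
  proof (rule Lim_null_comparison)
    have "norm (\<psi> (pprt (P f - T t f))) \<le> norm \<psi> * norm (P f - T t f)" for t
      using norm_blinfun mult_left_mono[OF norm_pprt_le norm_ge_zero] by (rule order_trans)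
    then show "\<forall>\<^sub>F t in at_top_within J.
        norm (\<psi> (pprt (P f - T t f))) \<le> norm \<psi> * norm (P f - T t f)"
      by simp
    have "((\<lambda>t. norm \<psi> * norm (P f - T t f)) \<longlongrightarrow> norm \<psi> * norm (P f - P f)) (at_top_within J)"
      by (intro tendsto_intros lim)
    then show "((\<lambda>t. norm \<psi> * norm (P f - T t f)) \<longlongrightarrow> 0) (at_top_within J)"
      by simp
  qed
qed

theorem theorem6p2:
  fixes J :: "real set"
    and T :: "real \<Rightarrow> 'a::banach_lattice \<Rightarrow>\<^sub>L 'a"
    and M :: real
    and f\<^sub>0 :: 'a
    and \<psi> :: "'a \<Rightarrow>\<^sub>L real"
  assumes "order_continuous_norm TYPE('a)"
    and "J = \<nat> - {0} \<or> J = {0<..}"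
    and "semigroup_on J T"
    and "bounded (T ` J)"
    and "positive_on J T"
    and "M > 0"
    and "quasi_interior f\<^sub>0"
    and "strictly_positive \<psi>"
    and "\<And>t. t \<in> J \<Longrightarrow> T t f\<^sub>0 \<le> M *\<^sub>R f\<^sub>0"
    and "\<And>t. t \<in> J \<Longrightarrow> dual_le (dual_op (T t) \<psi>) (M *\<^sub>R \<psi>)"
  shows "(\<exists>P. converges_strongly_to J T P \<and> (\<exists>\<epsilon>>0. dual_le (\<epsilon> *\<^sub>R \<psi>) (dual_op P \<psi>)))
    \<longleftrightarrow>
    (\<exists>h :: 'a \<Rightarrow> 'a.
       (\<forall>f. 0 \<le> f \<and> \<psi> f = 1 \<longrightarrow> h f \<noteq> 0 \<and> lower_bound J T \<psi> f (h f)) \<and>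
       (INF f\<in>{f. 0 \<le> f \<and> \<psi> f = 1}. ereal (\<psi> (h f))) > 0)"
    (is "?convergent \<longleftrightarrow> ?bounded_below")
proof -
  interpret dominated_semigroup J T M f\<^sub>0 \<psi>
    using assms by unfold_locales
  show ?thesis
  proof
    assume ?convergent
    then obtain P \<epsilon> where P: "converges_strongly_to J T P" and "\<epsilon> > 0"
      and le: "dual_le (\<epsilon> *\<^sub>R \<psi>) (dual_op P \<psi>)"
      by blast
    have eps: "\<epsilon> \<le> \<psi> (P f)" if "0 \<le> f" "\<psi> f = 1" for f
      using le that by (auto simp: dual_le_def dual_op_def blinfun.scaleR_left)
    show ?bounded_below
    proof (intro exI[of _ "\<lambda>f. P f"] conjI allI impI)
      fix f
      assume f: "0 \<le> f \<and> \<psi> f = 1"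
      show "P f \<noteq> 0"
        using eps[of f] f \<open>\<epsilon> > 0\<close> by auto
      show "lower_bound J T \<psi> f (P f)"
        using P f by (intro limit_lower) auto
    next
      have "0 < ereal \<epsilon>"
        using \<open>\<epsilon> > 0\<close> by simp
      also have "ereal \<epsilon> \<le> (INF f\<in>{f. 0 \<le> f \<and> \<psi> f = 1}. ereal (\<psi> (P f)))"
        using eps by (intro INF_greatest) auto
      finally show "(INF f\<in>{f. 0 \<le> f \<and> \<psi> f = 1}. ereal (\<psi> (P f))) > 0" .
    qed
  next
    assume ?bounded_below
    then obtain h where h: "\<And>f. 0 \<le> f \<Longrightarrow> \<psi> f = 1 \<Longrightarrow> lower f (h f)"
      and pos: "0 < (INF f\<in>{f. 0 \<le> f \<and> \<psi> f = 1}. ereal (\<psi> (h f)))"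
      by blast
    obtain \<epsilon> where \<epsilon>: "0 < ereal \<epsilon>" "ereal \<epsilon> < (INF f\<in>{f. 0 \<le> f \<and> \<psi> f = 1}. ereal (\<psi> (h f)))"
      using ereal_dense2[OF pos] by blast
    have "\<epsilon> \<le> \<psi> (h f)" if "0 \<le> f" "\<psi> f = 1" for f
    proof -
      have "(INF f\<in>{f. 0 \<le> f \<and> \<psi> f = 1}. ereal (\<psi> (h f))) \<le> ereal (\<psi> (h f))"
        using that by (intro INF_lower) auto
      with \<epsilon>(2) have "ereal \<epsilon> < ereal (\<psi> (h f))"
        by (rule less_le_trans)
      then show ?thesis
        by simp
    qed
    then have "\<exists>h. lower f h \<and> \<epsilon> * \<psi> f \<le> \<psi> h" if "0 \<le> f" for f
      using h by (intro uniform_lower_if_normalised[of h]) (simp_all add: that)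
    then interpret uniformly_bounded_below J T M f\<^sub>0 \<psi> \<epsilon>
      using \<epsilon>(1) by unfold_locales auto
    show ?convergent
      using strong_convergence eps_pos by blast
  qed
qed

end
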